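(* Let $\mathcal{T}\in\mathbb{R}^{I\times I\times\cdots\times I}$ be an $N$-way symmetric tensor with an exact independent symmetric Tucker decomposition $\mathcal{T}=[\![\mathcal{G}^s;\mathbf{X},\mathbf{X},\ldots,\mathbf{X}]\!]$, where $\mathcal{G}^s\in\mathbb{R}^{J\times\cdots\times J}$ and $\mathbf{X}\in\mathbb{R}^{I\times J}$. Define $$\hat{\mathcal{G}}^s=\mathcal{G}^s\times_1(\mathbf{X}^{\mathrm T}\mathbf{X})^{1/2}\times_2\cdots\times_N(\mathbf{X}^{\mathrm T}\mathbf{X})^{1/2}.$$ Then every Z-eigenvalue of $\hat{\mathcal{G}}^s$ is also a Z-eigenvalue of $\mathcal{T}$, and every non-zero Z-eigenvalue of $\mathcal{T}$ is also a Z-eigenvalue of $\hat{\mathcal{G}}^s$.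
   Context: Everything is over the real field, and $N\ge2$. Mode-$n$ product: for an $N$-way tensor $\mathcal{X}$ of size $I_1\times\cdots\times I_N$ and a $J\times I_n$ matrix $\mathbf{A}$, $[\mathcal{X}\times_n\mathbf{A}]_{i_1\cdots i_{n-1}ji_{n+1}\cdots i_N}=\sum_{i_n=1}^{I_n}x_{i_1\cdots i_N}a_{ji_n}$. A tensor is symmetric if all its dimensions are equal and its entries are invariant under all permutations of the indices. A symmetric Tucker decomposition $\mathcal{T}=[\![\mathcal{G}^s;\mathbf{X},\ldots,\mathbf{X}]\!]$ means $\mathcal{T}=\mathcal{G}^s\times_1\mathbf{X}\times_2\cdots\times_N\mathbf{X}$ (all factor matrices identical); it is independent if $\mathbf{X}$ has full column rank. $(\mathbf{X}^{\mathrm T}\mathbf{X})^{1/2}$ is the symmetric positive definite square root. Z-eigenvalue: for a symmetric $N$-way tensor $\mathcal{T}\in\mathbb{R}^{I\times\cdots\times I}$ and $\mathbf{x}\in\mathbb{R}^I$, let $\mathcal{T}(\mathbf{x}^{\circ(N-1)})\in\mathbb{R}^I$ be the vector with $i_N$-th entry $\sum_{i_1,\ldots,i_{N-1}=1}^I T_{i_1\cdots i_{N-1}i_N}x_{i_1}\cdots x_{i_{N-1}}$. A number $\lambda\in\mathbb{R}$ is a Z-eigenvalue of $\mathcal{T}$ if there is $\mathbf{x}\in\mathbb{R}^I$ with $\mathcal{T}(\mathbf{x}^{\circ(N-1)})=\lambda\mathbf{x}$ and $\mathbf{x}^{\mathrm T}\mathbf{x}=1$. (The tensor $\hat{\mathcal{G}}^s$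 is symmetric, so its Z-eigenvalues are well-defined.) *)

theory Defs
  imports "Jordan_Normal_Form.DL_Rank" "HOL-Combinatorics.Permutations"
begin

definition valid_index :: "nat list \<Rightarrow> nat list \<Rightarrow> bool" where
  "valid_index ds i \<longleftrightarrow> length i = length ds \<and> (\<forall>n<length ds. i ! n < ds ! n)"

text \<open>A real tensor of size \<open>ds ! 0 \<times> \<dots> \<times> ds ! (N - 1)\<close>. Modes and indices are counted from 0.
  Entries at invalid indices are fixed, so that equality of tensors means equal sizes and
  equal entries.\<close>

typedef tensor = "{(ds, f) :: nat list \<times> (nat list \<Rightarrow> real) | ds f.
    \<forall>i. \<not> valid_index ds i \<longrightarrow> f i = undefined}"
  morphisms rep_tensor abs_tensor
  by (rule exI[of _ "([], \<lambda>_. undefined)"]) simp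

definition dims :: "tensor \<Rightarrow> nat list" where
  "dims T = fst (rep_tensor T)"

definition entry :: "tensor \<Rightarrow> nat list \<Rightarrow> real" where
  "entry T = snd (rep_tensor T)"

definition mk_tensor :: "nat list \<Rightarrow> (nat list \<Rightarrow> real) \<Rightarrow> tensor" where
  "mk_tensor ds f = abs_tensor (ds, \<lambda>i. if valid_index ds i then f i else undefined)"

lemma rep_mk_tensor:
  "rep_tensor (mk_tensor ds f) = (ds, \<lambda>i. if valid_index ds i then f i else undefined)"
  unfolding mk_tensor_def by (rule abs_tensor_inverse) auto

lemma dims_mk_tensor [simp]: "dims (mk_tensor ds f) = ds"
  by (simp add: dims_def rep_mk_tensor)

lemma entry_mk_tensor [simp]: "valid_index ds i \<Longrightarrow> entry (mk_tensor ds f) i = f i"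
  by (simp add: entry_def rep_mk_tensor)

lemma tensor_eqI:
  assumes "dims S = dims T" and "\<And>i. valid_index (dims T) i \<Longrightarrow> entry S i = entry T i"
  shows "S = T"
proof -
  have "entry S i = entry T i" for i
    using assms rep_tensor[of S] rep_tensor[of T]
    by (cases "valid_index (dims T) i") (auto simp: dims_def entry_def)
  then have "rep_tensor S = rep_tensor T"
    using assms(1) by (simp add: dims_def entry_def prod_eq_iff fun_eq_iff)
  then show ?thesis by (simp add: rep_tensor_inject)
qed

text \<open>The mode product is meaningful if \<open>n < length (dims T)\<close> and \<open>dim_col A = dims T ! n\<close>.\<close>

definition mode_prod :: "tensor \<Rightarrow> nat \<Rightarrow> real mat \<Rightarrow> tensor" where
  "mode_prod T n A = mk_tensor ((dims T)[n := dim_row A])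
     (\<lambda>i. \<Sum>k<dims T ! n. entry T (i[n := k]) * A $$ (i ! n, k))"

definition tucker :: "tensor \<Rightarrow> real mat list \<Rightarrow> tensor" where
  "tucker G As = fold (\<lambda>n T. mode_prod T n (As ! n)) [0..<length As] G"

definition symmetric_tensor :: "tensor \<Rightarrow> bool" where
  "symmetric_tensor T \<longleftrightarrow>
     (\<forall>m<length (dims T). \<forall>n<length (dims T). dims T ! m = dims T ! n) \<and>
     (\<forall>p i. p permutes {..<length (dims T)} \<and> valid_index (dims T) i \<longrightarrow>
        entry T (permute_list p i) = entry T i)"

definition full_column_rank :: "real mat \<Rightarrow> bool" where
  "full_column_rank A \<longleftrightarrow> vec_space.rank (dim_row A) A = dim_col A"

definition sym_pos_def :: "real mat \<Rightarrow> bool" where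
  "sym_pos_def A \<longleftrightarrow> square_mat A \<and> A\<^sup>T = A \<and>
     (\<forall>v\<in>carrier_vec (dim_row A). v \<noteq> 0\<^sub>v (dim_row A) \<longrightarrow> v \<bullet> (A *\<^sub>v v) > 0)"

text \<open>Every symmetric positive definite matrix has exactly one such root.\<close>

definition spd_sqrt :: "real mat \<Rightarrow> real mat" where
  "spd_sqrt A = (THE S. S \<in> carrier_mat (dim_row A) (dim_row A) \<and> sym_pos_def S \<and> S * S = A)"

text \<open>Contraction with \<open>x\<close> in all modes but the last.\<close>

definition tensor_apply :: "tensor \<Rightarrow> real vec \<Rightarrow> real vec" where
  "tensor_apply T x = vec (last (dims T)) (\<lambda>j.
     \<Sum>i | valid_index (butlast (dims T)) i.
       entry T (i @ [j]) * (\<Prod>m<length (dims T) - 1. x $ (i ! m)))"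

definition Z_eigenvalue :: "tensor \<Rightarrow> real \<Rightarrow> bool" where
  "Z_eigenvalue T \<mu> \<longleftrightarrow>
     (\<exists>x\<in>carrier_vec (last (dims T)). tensor_apply T x = \<mu> \<cdot>\<^sub>v x \<and> x \<bullet> x = 1)"

end

theory Submission
  imports Defs "Jordan_Normal_Form.Spectral_Radius"
begin

text \<open>For every matrix \<open>A\<close>, applying the Tucker tensor \<open>G \<times>\<^sub>1 A \<dots> \<times>\<^sub>N A\<close> to \<open>x\<close> gives
  \<open>A F(A\<^sup>T x)\<close>, where \<open>F\<close> is the application of \<open>G\<close>. With \<open>S = (X\<^sup>T X)\<^sup>1\<^sup>/\<^sup>2\<close>, the eigenvalue
  equations of \<open>T\<close> and \<open>Ghat\<close> are therefore \<open>X F(X\<^sup>T x) = \<mu> x\<close> and \<open>S F(S y) = \<mu> y\<close>. Solutions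
  correspond through \<open>x = X f\<close> and \<open>y = S f\<close>, because \<open>X\<^sup>T X = S S\<close> gives \<open>X\<^sup>T x = S y\<close> and
  \<open>x \<bullet> x = y \<bullet> y\<close>. Every \<open>y\<close> has the form \<open>S f\<close> since \<open>S\<close> is invertible, and \<open>x\<close> has the form
  \<open>X f\<close> as soon as \<open>\<mu> \<noteq> 0\<close>.

  The root \<open>S\<close> exists by the spectral theorem for real symmetric matrices, which follows by deflation
  with Householder reflections.\<close>

section \<open>Index sums, entries of Tucker tensors and their contraction with a vector\<close>

lemma sum_valid_index_snoc:
  "(\<Sum>i | valid_index (ds @ [d]) i. f i) = (\<Sum>i | valid_index ds i. \<Sum>k<d. f (i @ [k]))"
proof -
  have "{i. valid_index (ds @ [d]) i} = (\<lambda>(i, k). i @ [k]) ` ({i. valid_index ds i} \<times> {..<d})"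
  proof (intro equalityI subsetI)
    fix i assume "i \<in> {i. valid_index (ds @ [d]) i}"
    then have i: "length i = Suc (length ds)" "\<And>n. n < Suc (length ds) \<Longrightarrow> i ! n < (ds @ [d]) ! n"
      by (auto simp: valid_index_def)
    then have "i = butlast i @ [last i]"
      by (metis append_butlast_last_id length_0_conv nat.distinct(1))
    moreover have "valid_index ds (butlast i)"
      using i(1) i(2) by (auto simp: valid_index_def nth_butlast) (metis less_SucI nth_append_left)
    moreover have "last i < d"
      using i(1) i(2)[of "length ds"] by (subst last_conv_nth) auto
    ultimately show "i \<in> (\<lambda>(i, k). i @ [k]) ` ({i. valid_index ds i} \<times> {..<d})"
      by (metis (mono_tags, lifting) SigmaI case_prod_conv image_eqI lessThan_iff mem_Collect_eq)
  qed (auto simp: valid_index_def nth_append less_Suc_eq)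
  then show ?thesis
    by (simp add: sum.reindex inj_on_def sum.cartesian_product o_def case_prod_unfold)
qed

text \<open>Distributivity for any number of factors: multiplying out picks one summand per mode,
  and these choices are exactly the index lists. It later expands products of coordinates of
  \<open>A\<^sup>T *\<^sub>v x\<close>.\<close>

lemma prod_sum_valid_index:
  fixes f :: "nat \<Rightarrow> nat \<Rightarrow> real"
  shows "(\<Prod>m<length ds. \<Sum>c<ds ! m. f m c) = (\<Sum>i | valid_index ds i. \<Prod>m<length ds. f m (i ! m))"
proof (induction ds rule: rev_induct)
  case Nil
  have "{i. valid_index [] i} = {[]}"
    by (auto simp: valid_index_def)
  then show ?case by simp
next
  case (snoc d ds)
  have "(\<Prod>m<length (ds @ [d]). \<Sum>c<(ds @ [d]) ! m. f m c)
      = (\<Prod>m<length ds. \<Sum>c<ds ! m. f m c) * (\<Sum>c<d. f (length ds) c)"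
    by (simp add: nth_append)
  also have "\<dots> = (\<Sum>i | valid_index ds i. \<Sum>c<d. (\<Prod>m<length ds. f m (i ! m)) * f (length ds) c)"
    by (simp add: snoc.IH sum_product)
  also have "\<dots> = (\<Sum>i | valid_index (ds @ [d]) i. \<Prod>m<length (ds @ [d]). f m (i ! m))"
    unfolding sum_valid_index_snoc
    by (intro sum.cong refl) (auto simp: valid_index_def nth_append)
  finally show ?case .
qed

text \<open>Invariant of the fold after \<open>n\<close> mode products: modes below \<open>n\<close>
  have been summed against their factor matrices, while the index entries from \<open>n\<close> on
  still address \<open>G\<close> directly, hence \<open>k @ drop n i\<close>.\<close>

lemma fold_mode_prod:
  assumes G: "dims G = map dim_col As" and "n \<le> length As"
  defines "S \<equiv> fold (\<lambda>n T. mode_prod T n (As ! n)) [0..<n] G"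
  shows "dims S = map dim_row (take n As) @ drop n (dims G)"
    and "valid_index (dims S) i \<Longrightarrow> entry S i =
      (\<Sum>k | valid_index (take n (dims G)) k.
        entry G (k @ drop n i) * (\<Prod>m<n. As ! m $$ (i ! m, k ! m)))"
proof -
  \<comment> \<open>\<open>S\<close> belongs to one fixed \<open>n\<close>; the induction needs the
    fold as a function of \<open>n\<close>.\<close>
  define F where "F n = fold (\<lambda>n T. mode_prod T n (As ! n)) [0..<n] G" for n
  have *: "dims (F n) = map dim_row (take n As) @ drop n (dims G) \<and>
    (\<forall>i. valid_index (dims (F n)) i \<longrightarrow> entry (F n) i =
      (\<Sum>k | valid_index (take n (dims G)) k.
        entry G (k @ drop n i) * (\<Prod>m<n. As ! m $$ (i ! m, k ! m))))"
    using assms(2)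
  proof (induction n)
    case 0
    have "{i. valid_index [] i} = {[]}"
      by (auto simp: valid_index_def)
    then show ?case by (simp add: F_def)
  next
    case (Suc n)
    then have n: "n < length As" by simp
    have d: "dims (F n) = map dim_row (take n As) @ drop n (dims G)" using Suc by simp
    have Fs: "F (Suc n) = mode_prod (F n) n (As ! n)" by (simp add: F_def)
    have d': "dims (F (Suc n)) = map dim_row (take (Suc n) As) @ drop (Suc n) (dims G)"
      using n by (simp add: Fs mode_prod_def d list_update_append take_Suc_conv_app_nth G
        Cons_nth_drop_Suc[symmetric] del: upt_Suc)
    show ?case
    proof (intro conjI d' allI impI)
      fix i assume "valid_index (dims (F (Suc n))) i"
      then have vi: "valid_index ((dims (F n))[n := dim_row (As ! n)]) i"
        by (simp add: Fs mode_prod_def)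
      have lF: "length (dims (F n)) = length As" using n by (simp add: d G)
      have li: "length i = length As" using vi lF by (simp add: valid_index_def)
      have dn: "dims (F n) ! n = dims G ! n" using n by (simp add: d nth_append G)
      \<comment> \<open>The new product changes the size of mode \<open>n\<close> only, so an index
        becomes valid for the previous tensor once position \<open>n\<close> holds a summation index
        of \<open>G\<close>.\<close>
      have v: "valid_index (dims (F n)) (i[n := k])" if "k < dims G ! n" for k
        using vi that lF n li dn unfolding valid_index_def
        by (auto simp: nth_list_update)
      have "entry (F (Suc n)) i = (\<Sum>k<dims G ! n. entry (F n) (i[n := k]) * As ! n $$ (i ! n, k))"
        using vi by (simp add: Fs mode_prod_def dn)
      \<comment> \<open>The induction hypothesis is applied at \<open>i[n := k]\<close>: the new
        summation index \<open>k\<close> is appended to \<open>l\<close>, and its matrix entry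
        becomes the last factor of the product.\<close>
      also have "\<dots> = (\<Sum>k<dims G ! n. \<Sum>l | valid_index (take n (dims G)) l.
         entry G ((l @ [k]) @ drop (Suc n) i)
           * (\<Prod>m<Suc n. As ! m $$ (i ! m, (l @ [k]) ! m)))"
      proof (rule sum.cong[OF refl])
        fix k assume k: "k \<in> {..<dims G ! n}"
        have dr: "drop n (i[n := k]) = k # drop (Suc n) i"
          using n li by (simp add: upd_conv_take_nth_drop)
        have "entry (F n) (i[n := k]) = (\<Sum>l | valid_index (take n (dims G)) l.
            entry G (l @ drop n (i[n := k])) * (\<Prod>m<n. As ! m $$ (i[n := k] ! m, l ! m)))"
          using Suc v[of k] k by simp
        then show "entry (F n) (i[n := k]) * As ! n $$ (i ! n, k) =
          (\<Sum>l | valid_index (take n (dims G)) l. entry G ((l @ [k]) @ drop (Suc n) i)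
           * (\<Prod>m<Suc n. As ! m $$ (i ! m, (l @ [k]) ! m)))"
          using n by (auto simp: dr sum_distrib_right valid_index_def G nth_append intro!: sum.cong)
      qed
      also have "\<dots> = (\<Sum>l | valid_index (take n (dims G) @ [dims G ! n]) l.
         entry G (l @ drop (Suc n) i) * (\<Prod>m<Suc n. As ! m $$ (i ! m, l ! m)))"
        unfolding sum_valid_index_snoc by (rule sum.swap)
      also have "take n (dims G) @ [dims G ! n] = take (Suc n) (dims G)"
        using n by (simp add: take_Suc_conv_app_nth G)
      finally show "entry (F (Suc n)) i = (\<Sum>k | valid_index (take (Suc n) (dims G)) k.
        entry G (k @ drop (Suc n) i) * (\<Prod>m<Suc n. As ! m $$ (i ! m, k ! m)))" .
    qed
  qed
  show "dims S = map dim_row (take n As) @ drop n (dims G)"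
    and "valid_index (dims S) i \<Longrightarrow> entry S i =
      (\<Sum>k | valid_index (take n (dims G)) k.
        entry G (k @ drop n i) * (\<Prod>m<n. As ! m $$ (i ! m, k ! m)))"
    using * by (simp_all add: S_def F_def)
qed

lemma dims_tucker: "dims G = map dim_col As \<Longrightarrow> dims (tucker G As) = map dim_row As"
  using fold_mode_prod(1)[of G As "length As"] by (simp add: tucker_def)

lemma entry_tucker:
  assumes G: "dims G = map dim_col As" and i: "valid_index (map dim_row As) i"
  shows "entry (tucker G As) i =
    (\<Sum>k | valid_index (dims G) k. entry G k * (\<Prod>m<length As. As ! m $$ (i ! m, k ! m)))"
  using fold_mode_prod(2)[OF G order_refl, of i] i dims_tucker[OF G]
  by (simp add: tucker_def G valid_index_def)

text \<open>Multilinearity: contracting a mode with \<open>x\<close> moves \<open>A\<close> onto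
  \<open>x\<close> as \<open>A\<^sup>T *\<^sub>v x\<close>. The last mode is not contracted, so its
  copy of \<open>A\<close> stays outside and acts on the result.\<close>

lemma tensor_apply_tucker:
  assumes N: "N \<ge> 1" and G: "dims G = replicate N J"
    and A: "A \<in> carrier_mat I J" and x: "x \<in> carrier_vec I"
  shows "tensor_apply (tucker G (replicate N A)) x = A *\<^sub>v tensor_apply G (A\<^sup>T *\<^sub>v x)"
proof -
  \<comment> \<open>\<open>M\<close> is the number of contracted modes.\<close>
  obtain M where M: "N = Suc M" using N by (cases N) auto
  let ?T = "tucker G (replicate N A)"
  have G': "dims G = map dim_col (replicate N A)" using G A by simp
  have dT: "dims ?T = replicate M I @ [I]"
    using dims_tucker[OF G'] A by (simp add: M replicate_append_same)
  have dG: "dims G = replicate M J @ [J]"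
    using G by (simp add: M replicate_append_same)
  define a where "a j = (\<Prod>m<M. (A\<^sup>T *\<^sub>v x) $ (j ! m))" for j
  \<comment> \<open>For fixed \<open>k\<close> the sum over \<open>i\<close> factors mode by mode,
    each factor being one coordinate of \<open>A\<^sup>T *\<^sub>v x\<close>.\<close>
  have a: "(\<Sum>i | valid_index (replicate M I) i. (\<Prod>m<M. A $$ (i ! m, k ! m)) * (\<Prod>m<M. x $ (i ! m)))
      = a k" if k: "valid_index (replicate M J) k" for k
  proof -
    have "(A\<^sup>T *\<^sub>v x) $ (k ! m) = (\<Sum>c<I. A $$ (c, k ! m) * x $ c)" if "m < M" for m
      using k that A x by (auto simp: valid_index_def scalar_prod_def atLeast0LessThan)
    then have "a k = (\<Prod>m<length (replicate M I). \<Sum>c<replicate M I ! m. A $$ (c, k ! m) * x $ c)"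
      by (simp add: a_def)
    then show ?thesis
      by (simp add: prod_sum_valid_index prod.distrib del: length_replicate)
        (simp add: prod.distrib)
  qed
  show ?thesis
  proof (rule eq_vecI)
    show "dim_vec (tensor_apply ?T x) = dim_vec (A *\<^sub>v tensor_apply G (A\<^sup>T *\<^sub>v x))"
      using A by (simp add: tensor_apply_def dT)
    fix j assume "j < dim_vec (A *\<^sub>v tensor_apply G (A\<^sup>T *\<^sub>v x))"
    then have j: "j < I" using A by simp
    have e: "entry ?T (i @ [j]) = (\<Sum>k | valid_index (replicate M J) k. \<Sum>l<J.
        entry G (k @ [l]) * ((\<Prod>m<M. A $$ (i ! m, k ! m)) * A $$ (j, l)))"
      if i: "valid_index (replicate M I) i" for i
    proof -
      have "valid_index (map dim_row (replicate N A)) (i @ [j])"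
        using i j A by (auto simp: valid_index_def M nth_append less_Suc_eq nth_Cons')
      note entry_tucker[OF G' this, unfolded dG sum_valid_index_snoc]
      also have "(\<Sum>k | valid_index (replicate M J) k. \<Sum>l<J. entry G (k @ [l]) *
            (\<Prod>m<length (replicate N A). replicate N A ! m $$ ((i @ [j]) ! m, (k @ [l]) ! m)))
        = (\<Sum>k | valid_index (replicate M J) k. \<Sum>l<J.
            entry G (k @ [l]) * ((\<Prod>m<M. A $$ (i ! m, k ! m)) * A $$ (j, l)))"
      proof (intro sum.cong refl)
        fix k l assume "k \<in> {k. valid_index (replicate M J) k}"
        then have "length i = M" "length k = M" using i by (auto simp: valid_index_def)
        then show "entry G (k @ [l]) *
            (\<Prod>m<length (replicate N A). replicate N A ! m $$ ((i @ [j]) ! m, (k @ [l]) ! m))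
          = entry G (k @ [l]) * ((\<Prod>m<M. A $$ (i ! m, k ! m)) * A $$ (j, l))"
          by (auto simp: M nth_append simp del: replicate_Suc intro!: prod.cong)
      qed
      finally show ?thesis .
    qed
    have "tensor_apply ?T x $ j = (\<Sum>i | valid_index (replicate M I) i.
        entry ?T (i @ [j]) * (\<Prod>m<M. x $ (i ! m)))"
      using j by (simp add: tensor_apply_def dT)
    also have "\<dots> = (\<Sum>i | valid_index (replicate M I) i. \<Sum>k | valid_index (replicate M J) k. \<Sum>l<J.
        A $$ (j, l) * (entry G (k @ [l]) * ((\<Prod>m<M. A $$ (i ! m, k ! m)) * (\<Prod>m<M. x $ (i ! m)))))"
      by (intro sum.cong refl) (simp add: e sum_distrib_right sum_distrib_left mult_ac)
    \<comment> \<open>Moving the sum over \<open>i\<close> innermost isolates the expression that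
      equals \<open>a k\<close>.\<close>
    also have "\<dots> = (\<Sum>k | valid_index (replicate M J) k. \<Sum>l<J. \<Sum>i | valid_index (replicate M I) i.
        A $$ (j, l) * (entry G (k @ [l]) * ((\<Prod>m<M. A $$ (i ! m, k ! m)) * (\<Prod>m<M. x $ (i ! m)))))"
      by (subst sum.swap, rule sum.cong[OF refl], rule sum.swap)
    also have "\<dots> = (\<Sum>k | valid_index (replicate M J) k. \<Sum>l<J. A $$ (j, l) * (entry G (k @ [l]) * a k))"
      by (intro sum.cong refl) (simp add: a[symmetric] sum_distrib_left)
    also have "\<dots> = (\<Sum>l<J. A $$ (j, l) *
        (\<Sum>k | valid_index (replicate M J) k. entry G (k @ [l]) * a k))"
      by (subst sum.swap) (simp add: sum_distrib_left)
    also have "\<dots> = (A *\<^sub>v tensor_apply G (A\<^sup>T *\<^sub>v x)) $ j"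
      using j A by (auto simp: tensor_apply_def dG scalar_prod_def atLeast0LessThan a_def intro!: sum.cong)
    finally show "tensor_apply ?T x $ j = (A *\<^sub>v tensor_apply G (A\<^sup>T *\<^sub>v x)) $ j" .
  qed
qed

section \<open>Spectral theorem for real symmetric matrices\<close>

lemma vec_eq_if_minus_eq_0:
  fixes x y :: "'a :: group_add vec"
  assumes "x - y = 0\<^sub>v n" "x \<in> carrier_vec n" "y \<in> carrier_vec n"
  shows "x = y"
proof (rule eq_vecI)
  fix i assume "i < dim_vec y"
  then show "x $ i = y $ i"
    using arg_cong[OF assms(1), of "\<lambda>v. v $ i"] index_minus_vec(1)[of i y x] assms(3) by simp
qed (use assms in simp)

lemma mat_eq_if_minus_eq_0:
  fixes A B :: "'a :: group_add mat"
  assumes "A - B = 0\<^sub>m m n" "A \<in> carrier_mat m n" "B \<in> carrier_mat m n"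
  shows "A = B"
proof (rule eq_matI)
  fix i j assume "i < dim_row B" "j < dim_col B"
  then show "A $$ (i, j) = B $$ (i, j)"
    using arg_cong[OF assms(1), of "\<lambda>M. M $$ (i, j)"] index_minus_mat(1)[of i B j A] assms(3) by simp
qed (use assms in simp_all)

lemma scalar_prod_self_pos:
  fixes v :: "real vec"
  assumes "v \<in> carrier_vec n" "v \<noteq> 0\<^sub>v n"
  shows "v \<bullet> v > 0"
proof -
  obtain i where "i < n" "v $ i \<noteq> 0"
    using assms by (metis carrier_vecD eq_vecI index_zero_vec)
  then show ?thesis
    using assms by (auto simp: scalar_prod_def intro!: sum_pos2[of _ i])
qed

lemma symmetric_mat_scalar_prod:
  fixes A :: "'a :: comm_semiring_0 mat"
  assumes "A \<in> carrier_mat n n" "A\<^sup>T = A" "x \<in> carrier_vec n" "y \<in> carrier_vec n"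
  shows "(A *\<^sub>v x) \<bullet> y = x \<bullet> (A *\<^sub>v y)"
  using transpose_vec_mult_scalar[of A n n y x] assms by simp

lemma mult_unit_vec_eq_col:
  fixes A :: "'a :: semiring_1 mat"
  assumes "A \<in> carrier_mat nr nc" "i < nc"
  shows "A *\<^sub>v unit_vec nc i = col A i"
  using assms by (intro eq_vecI) auto

text \<open>Over the complex numbers an eigenvector exists as soon as \<open>n > 0\<close>. Its real
  or its imaginary part is a nonzero real eigenvector, which is then scaled to length 1.\<close>

lemma symmetric_mat_unit_eigenvector:
  fixes A :: "real mat"
  assumes A: "A \<in> carrier_mat n n" and sym: "A\<^sup>T = A" and n: "n > 0"
  obtains v \<mu> where "v \<in> carrier_vec n" "v \<bullet> v = 1" "A *\<^sub>v v = \<mu> \<cdot>\<^sub>v v"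
proof -
  let ?C = "map_mat complex_of_real A"
  have C: "?C \<in> carrier_mat n n" using A by simp
  obtain \<mu> z where z: "z \<in> carrier_vec n" "z \<noteq> 0\<^sub>v n" "?C *\<^sub>v z = \<mu> \<cdot>\<^sub>v z"
    using spectrum_non_empty[OF C n] C A
    by (auto simp: spectrum_def eigenvalue_def eigenvector_def)
  define x where "x = map_vec Re z"
  define y where "y = map_vec Im z"
  have x: "x \<in> carrier_vec n" and y: "y \<in> carrier_vec n" using z by (auto simp: x_def y_def)
  have Cz: "(\<Sum>j\<in>{0..<n}. complex_of_real (A $$ (i, j)) * z $ j) = \<mu> * z $ i" if "i < n" for i
    using arg_cong[OF z(3), of "\<lambda>v. v $ i"] that z(1) A by (simp add: scalar_prod_def)
  \<comment> \<open>Since \<open>A\<close> is real, \<open>Cz\<close> splits into its real part,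
    used here, and its imaginary part, used for \<open>Ay\<close>.\<close>
  have Ax: "A *\<^sub>v x = Re \<mu> \<cdot>\<^sub>v x - Im \<mu> \<cdot>\<^sub>v y"
  proof (rule eq_vecI)
    fix i assume "i < dim_vec (Re \<mu> \<cdot>\<^sub>v x - Im \<mu> \<cdot>\<^sub>v y)"
    then have "i < n" using y by simp
    then show "(A *\<^sub>v x) $ i = (Re \<mu> \<cdot>\<^sub>v x - Im \<mu> \<cdot>\<^sub>v y) $ i"
      using arg_cong[OF Cz[of i], of Re] A z(1) by (simp add: scalar_prod_def x_def y_def)
  qed (use A y in auto)
  have Ay: "A *\<^sub>v y = Im \<mu> \<cdot>\<^sub>v x + Re \<mu> \<cdot>\<^sub>v y"
  proof (rule eq_vecI)
    fix i assume "i < dim_vec (Im \<mu> \<cdot>\<^sub>v x + Re \<mu> \<cdot>\<^sub>v y)"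
    then have "i < n" using y by simp
    then show "(A *\<^sub>v y) $ i = (Im \<mu> \<cdot>\<^sub>v x + Re \<mu> \<cdot>\<^sub>v y) $ i"
      using arg_cong[OF Cz[of i], of Im] A z(1) by (simp add: scalar_prod_def x_def y_def)
  qed (use A y in auto)
  have nz: "x \<noteq> 0\<^sub>v n \<or> y \<noteq> 0\<^sub>v n"
  proof (rule ccontr)
    assume "\<not> ?thesis"
    then have "x $ i = 0" "y $ i = 0" if "i < n" for i using that by auto
    then have "z = 0\<^sub>v n"
      using z(1) by (intro eq_vecI) (auto simp: x_def y_def complex_eq_iff)
    then show False using z(2) by simp
  qed
  \<comment> \<open>Symmetry forces the eigenvalue to be real, so both \<open>x\<close> and \<open>y\<close> are candidates.\<close>
  have "(A *\<^sub>v x) \<bullet> y = x \<bullet> (A *\<^sub>v y)"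
    by (rule symmetric_mat_scalar_prod[OF A sym x y])
  then have "Im \<mu> * (x \<bullet> x + y \<bullet> y) = 0"
    using x y by (simp add: Ax Ay minus_scalar_prod_distrib[of _ n] scalar_prod_add_distrib[of _ n]
      comm_scalar_prod[of y n x] algebra_simps)
  moreover have "x \<bullet> x + y \<bullet> y > 0"
    using nz scalar_prod_self_pos[of x n] scalar_prod_self_pos[of y n] x y
    by (cases "x = 0\<^sub>v n"; cases "y = 0\<^sub>v n") auto
  ultimately have "Im \<mu> = 0" by simp
  then have "A *\<^sub>v x = Re \<mu> \<cdot>\<^sub>v x" "A *\<^sub>v y = Re \<mu> \<cdot>\<^sub>v y"
    using Ax Ay x y by (auto intro!: eq_vecI)
  then obtain u where u: "u \<in> carrier_vec n" "u \<noteq> 0\<^sub>v n" "A *\<^sub>v u = Re \<mu> \<cdot>\<^sub>v u"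
    using nz x y by blast
  define c where "c = 1 / sqrt (u \<bullet> u)"
  have "c * (c * (u \<bullet> u)) = 1"
    using scalar_prod_self_pos[OF u(1,2)] by (simp add: c_def)
  then have "(c \<cdot>\<^sub>v u) \<bullet> (c \<cdot>\<^sub>v u) = 1" using u by simp
  moreover have "A *\<^sub>v (c \<cdot>\<^sub>v u) = Re \<mu> \<cdot>\<^sub>v (c \<cdot>\<^sub>v u)"
    using u by (simp add: mult_mat_vec[OF A] smult_smult_assoc mult.commute)
  ultimately show thesis using that[of "c \<cdot>\<^sub>v u"] u(1) by simp
qed

text \<open>The witness is the Householder reflection along \<open>v - unit_vec n 0\<close>.\<close>
lemma symmetric_involution_unit_vec:
  fixes v :: "real vec"
  assumes v: "v \<in> carrier_vec n" "v \<bullet> v = 1" and n: "n > 0"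
  obtains U where "U \<in> carrier_mat n n" "U\<^sup>T = U" "U * U = 1\<^sub>m n" "U *\<^sub>v v = unit_vec n 0"
proof (cases "v = unit_vec n 0")
  case True
  then show thesis using that[of "1\<^sub>m n"] v by simp
next
  case False
  define w where "w = v - unit_vec n 0"
  define c where "c = 2 / (w \<bullet> w)"
  define U where "U = mat n n (\<lambda>(i, j). (if i = j then 1 else 0) - c * w $ i * w $ j)"
  have w: "w \<in> carrier_vec n" using v by (simp add: w_def)
  have "w \<noteq> 0\<^sub>v n"
  proof
    assume "w = 0\<^sub>v n"
    then show False
      using False v vec_eq_if_minus_eq_0[of v "unit_vec n 0" n] by (simp add: w_def)
  qed
  then have ww: "w \<bullet> w > 0" using scalar_prod_self_pos w by blast
  \<comment> \<open>Both \<open>v\<close> and the unit vector have length 1, so both sides equal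
    \<open>2 - 2 * v $ 0\<close>. With this \<open>c\<close>, the reflection subtracts exactly
    \<open>w\<close> from \<open>v\<close>.\<close>
  have "w \<bullet> w = 2 * (w \<bullet> v)"
    using v n by (simp add: w_def minus_scalar_prod_distrib[of _ n] scalar_prod_minus_distrib[of _ n])
  then have cv: "c * (w \<bullet> v) = 1" using ww by (simp add: c_def)
  have U: "U \<in> carrier_mat n n" by (simp add: U_def)
  have Ux: "U *\<^sub>v x = x - (c * (w \<bullet> x)) \<cdot>\<^sub>v w" if x: "x \<in> carrier_vec n" for x
  proof (rule eq_vecI)
    fix i assume "i < dim_vec (x - (c * (w \<bullet> x)) \<cdot>\<^sub>v w)"
    then have i: "i < n" using w by simp
    then have "(U *\<^sub>v x) $ i = (\<Sum>j\<in>{0..<n}. (if i = j then x $ j else 0) - c * w $ i * (w $ j * x $ j))"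
      using x by (auto simp: U_def scalar_prod_def algebra_simps intro!: sum.cong)
    also have "\<dots> = x $ i - c * w $ i * (\<Sum>j\<in>{0..<n}. w $ j * x $ j)"
      using i by (simp add: sum_subtractf sum_distrib_left)
    finally show "(U *\<^sub>v x) $ i = (x - (c * (w \<bullet> x)) \<cdot>\<^sub>v w) $ i"
      using i w x by (simp add: scalar_prod_def)
  qed (use U w in auto)
  have cU: "U *\<^sub>v (U *\<^sub>v x) = x" if x: "x \<in> carrier_vec n" for x
  proof -
    \<comment> \<open>A reflection negates the component along \<open>w\<close>; a second
      application therefore undoes the first.\<close>
    have "c * (w \<bullet> (x - (c * (w \<bullet> x)) \<cdot>\<^sub>v w)) = - (c * (w \<bullet> x))"
      using x w ww by (simp add: scalar_prod_minus_distrib[of _ n] c_def field_simps)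
    then show ?thesis
      using x w by (simp add: Ux) (intro eq_vecI, auto)
  qed
  have UU: "U * U = 1\<^sub>m n"
  proof (rule eq_matI)
    fix i j assume "i < dim_row (1\<^sub>m n :: real mat)" "j < dim_col (1\<^sub>m n :: real mat)"
    then have "i < n" "j < n" by simp_all
    then have "(U * U) $$ (i, j) = (U *\<^sub>v (U *\<^sub>v unit_vec n j)) $ i"
      using U by (simp add: mult_unit_vec_eq_col[OF U])
    then show "(U * U) $$ (i, j) = 1\<^sub>m n $$ (i, j)"
      using \<open>i < n\<close> \<open>j < n\<close> by (simp add: cU)
  qed (use U in auto)
  moreover have "U\<^sup>T = U"
    by (rule eq_matI) (auto simp: U_def)
  moreover have "U *\<^sub>v v = unit_vec n 0"
    using v by (simp add: Ux cv) (intro eq_vecI, auto simp: w_def)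
  ultimately show thesis using that U by blast
qed

text \<open>Conjugation by a reflection sending a unit eigenvector to the first unit vector leaves,
  by symmetry, a 1-by-1 block and a smaller symmetric block, to which the induction hypothesis
  applies.\<close>

theorem real_symmetric_diagonalization:
  fixes A :: "real mat"
  assumes "A \<in> carrier_mat n n" "A\<^sup>T = A"
  shows "\<exists>U d. U \<in> carrier_mat n n \<and> U\<^sup>T * U = 1\<^sub>m n \<and> A = U * mat_diag n d * U\<^sup>T"
  using assms
proof (induction n arbitrary: A)
  case 0
  \<comment> \<open>All 0-by-0 matrices are equal, so any diagonal function serves.\<close>
  then show ?case by (intro exI[of _ "1\<^sub>m 0"] exI[of _ undefined]) (auto intro: eq_matI)
next
  case (Suc m)
  let ?n = "Suc m"
  note A = Suc.prems(1) and sym = Suc.prems(2)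
  obtain v \<mu> where v: "v \<in> carrier_vec ?n" "v \<bullet> v = 1" and Av: "A *\<^sub>v v = \<mu> \<cdot>\<^sub>v v"
    using symmetric_mat_unit_eigenvector[OF A sym] by blast
  obtain U where U: "U \<in> carrier_mat ?n ?n" "U\<^sup>T = U" "U * U = 1\<^sub>m ?n" "U *\<^sub>v v = unit_vec ?n 0"
    using symmetric_involution_unit_vec[OF v] by blast
  define B where "B = U * A * U"
  have B: "B \<in> carrier_mat ?n ?n" using U A by (simp add: B_def)
  have symB: "B\<^sup>T = B"
    using U A sym by (simp add: B_def transpose_mult[of _ ?n ?n _ ?n])
  \<comment> \<open>\<open>U\<close> is an involution and so also maps the unit vector back to
    \<open>v\<close>; this makes column 0 of \<open>B\<close> a multiple of the unit vector.\<close>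
  have Ue: "U *\<^sub>v unit_vec ?n 0 = v"
    using U v by (metis assoc_mult_mat_vec one_mult_mat_vec)
  have "col B 0 = (U * A * U) *\<^sub>v unit_vec ?n 0"
    using mult_unit_vec_eq_col[OF B, of 0] by (simp add: B_def)
  also have "\<dots> = U *\<^sub>v (A *\<^sub>v (U *\<^sub>v unit_vec ?n 0))"
    using U(1) A by (simp add:
      assoc_mult_mat_vec[of _ ?n ?n _ ?n] mult_carrier_mat[of _ ?n ?n] del: assoc_mult_mat)
  also have "\<dots> = \<mu> \<cdot>\<^sub>v unit_vec ?n 0"
    using U(4) v by (simp add: Ue Av mult_mat_vec[OF U(1)])
  finally have colB: "col B 0 = \<mu> \<cdot>\<^sub>v unit_vec ?n 0" .
  have B0: "B $$ (i, 0) = (if i = 0 then \<mu> else 0)" if "i < ?n" for i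
    using arg_cong[OF colB, of "\<lambda>x. x $ i"] that B by simp
  \<comment> \<open>Symmetry carries the zeros of column 0 over to row 0.\<close>
  have B0': "B $$ (0, j) = (if j = 0 then \<mu> else 0)" if "j < ?n" for j
    using B0[OF that] arg_cong[OF symB, of "\<lambda>M. M $$ (0, j)"] that B by simp
  define C where "C = mat m m (\<lambda>(i, j). B $$ (Suc i, Suc j))"
  have C: "C \<in> carrier_mat m m" by (simp add: C_def)
  have symC: "C\<^sup>T = C"
  proof (rule eq_matI)
    fix i j assume "i < dim_row C" "j < dim_col C"
    then show "C\<^sup>T $$ (i, j) = C $$ (i, j)"
      using arg_cong[OF symB, of "\<lambda>M. M $$ (Suc i, Suc j)"] B by (simp add: C_def)
  qed (auto simp: C_def)
  obtain V d where V: "V \<in> carrier_mat m m" "V\<^sup>T * V = 1\<^sub>m m" and CV: "C = V * mat_diag m d * V\<^sup>T"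
    using Suc.IH[OF C symC] by blast
  define W where "W = four_block_mat (1\<^sub>m 1) (0\<^sub>m 1 m) (0\<^sub>m m 1) V"
  have W: "W \<in> carrier_mat ?n ?n"
    using V by (auto simp: W_def)
  have Wt: "W\<^sup>T = four_block_mat (1\<^sub>m 1) (0\<^sub>m 1 m) (0\<^sub>m m 1) (V\<^sup>T)"
    using V by (simp add: W_def transpose_four_block_mat[of _ 1 1 _ m _ m])
  have WW: "W\<^sup>T * W = 1\<^sub>m ?n"
    unfolding Wt unfolding W_def using V
    by (subst mult_four_block_mat[of _ 1 1 _ m _ m _ _ 1 _ m]) (auto intro!: eq_matI)
  \<comment> \<open>\<open>case_nat \<mu> d\<close> puts \<mu> in front of the eigenvalues of
    \<open>C\<close>, matching the 1-by-1 block that \<open>W\<close> puts in front of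
    \<open>V\<close>.\<close>
  have D: "mat_diag ?n (case_nat \<mu> d) = four_block_mat (\<mu> \<cdot>\<^sub>m 1\<^sub>m 1) (0\<^sub>m 1 m) (0\<^sub>m m 1) (mat_diag m d)"
    by (rule eq_matI) (auto simp: mat_diag_def split: nat.splits)
  have "B = four_block_mat (\<mu> \<cdot>\<^sub>m 1\<^sub>m 1) (0\<^sub>m 1 m) (0\<^sub>m m 1) C"
    using B by (intro eq_matI) (auto simp: C_def B0 B0')
  also have "\<dots> = W * mat_diag ?n (case_nat \<mu> d) * W\<^sup>T"
  proof -
    have VD: "V * mat_diag m d \<in> carrier_mat m m" using V mult_carrier_mat by auto
    have "W * mat_diag ?n (case_nat \<mu> d)
        = four_block_mat (\<mu> \<cdot>\<^sub>m 1\<^sub>m 1) (0\<^sub>m 1 m) (0\<^sub>m m 1) (V * mat_diag m d)"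
      unfolding D W_def using V(1) VD
      by (subst mult_four_block_mat[of _ 1 1 _ m _ m _ _ 1 _ m])
        (simp_all add: right_mult_zero_mat[of _ m m] left_mult_zero_mat[of _ m m])
    then show ?thesis
      unfolding Wt using V(1) VD C[unfolded CV]
      by (simp add: mult_four_block_mat[of _ 1 1 _ m _ m _ _ 1 _ m] CV
        right_mult_zero_mat[of _ m m] left_mult_zero_mat[of _ m m] del: assoc_mult_mat)
  qed
  finally have BW: "B = W * mat_diag ?n (case_nat \<mu> d) * W\<^sup>T" .
  have "A = U * B * U"
  proof -
    have "U * B * U = (U * U) * A * (U * U)"
      using U(1) A by (simp add: B_def assoc_mult_mat[of _ ?n ?n _ ?n _ ?n] del: assoc_mult_mat)
    then show ?thesis using U A by simp
  qed
  also have "\<dots> = (U * W) * mat_diag ?n (case_nat \<mu> d) * (U * W)\<^sup>T"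
    using U W mat_diag_dim[of ?n "case_nat \<mu> d"]
    by (simp add: BW transpose_mult[of _ ?n ?n _ ?n] assoc_mult_mat[of _ ?n ?n _ ?n _ ?n]
      mult_carrier_mat[of _ ?n ?n] del: assoc_mult_mat)
  finally have "A = (U * W) * mat_diag ?n (case_nat \<mu> d) * (U * W)\<^sup>T" .
  moreover have "(U * W)\<^sup>T * (U * W) = 1\<^sub>m ?n"
  proof -
    have "(U * W)\<^sup>T * (U * W) = W\<^sup>T * ((U * U) * W)"
      using U(1,2) W by (simp add: transpose_mult[of _ ?n ?n _ ?n] assoc_mult_mat[of _ ?n ?n _ ?n _ ?n]
         mult_carrier_mat[of _ ?n ?n] del: assoc_mult_mat)
    then show ?thesis using U W WW by simp
  qed
  moreover have "U * W \<in> carrier_mat ?n ?n" using U W by simp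
  ultimately show ?case by blast
qed

section \<open>Positive definite matrices and their square roots\<close>

lemma sym_pos_def_if_eigenvalues_pos:
  assumes U: "U \<in> carrier_mat n n" "U\<^sup>T * U = 1\<^sub>m n" and d: "\<And>i. i < n \<Longrightarrow> d i > 0"
  shows "sym_pos_def (U * mat_diag n d * U\<^sup>T)"
proof -
  let ?A = "U * mat_diag n d * U\<^sup>T"
  have A: "?A \<in> carrier_mat n n" using U mult_carrier_mat by auto
  have "(mat_diag n d)\<^sup>T = mat_diag n d" by (rule eq_matI) (auto simp: mat_diag_def)
  then have sym: "?A\<^sup>T = ?A"
    using U(1) mat_diag_dim[of n d] by (simp add: transpose_mult[of _ n n _ n]
      assoc_mult_mat[of _ n n _ n _ n] mult_carrier_mat[of _ n n] del: assoc_mult_mat)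
  have "v \<bullet> (?A *\<^sub>v v) > 0" if v: "v \<in> carrier_vec n" "v \<noteq> 0\<^sub>v n" for v
  proof -
    \<comment> \<open>In the coordinates \<open>y\<close> the quadratic form is the sum of
      \<open>d i * (y $ i)\<^sup>2\<close>, which is positive because \<open>y\<close> is
      nonzero.\<close>
    define y where "y = U\<^sup>T *\<^sub>v v"
    have y: "y \<in> carrier_vec n" using U v by (simp add: y_def)
    have UU: "U * U\<^sup>T = 1\<^sub>m n"
      by (rule mat_mult_left_right_inverse[of "U\<^sup>T" n U]) (use U in auto)
    have "U *\<^sub>v y = v"
      using assoc_mult_mat_vec[of U n n "U\<^sup>T" n v] U v by (simp add: y_def UU)
    then have "y \<noteq> 0\<^sub>v n" using v U by auto
    then obtain k where k: "k < n" "y $ k \<noteq> 0"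
      using y by (metis carrier_vecD eq_vecI index_zero_vec)
    have "?A *\<^sub>v v = U *\<^sub>v (mat_diag n d *\<^sub>v y)"
      using U v mat_diag_dim[of n d] by (simp add: y_def assoc_mult_mat_vec[of _ n n _ n]
        mult_carrier_mat[of _ n n] del: assoc_mult_mat)
    then have "v \<bullet> (?A *\<^sub>v v) = y \<bullet> (mat_diag n d *\<^sub>v y)"
      using transpose_vec_mult_scalar[OF U(1) mult_mat_vec_carrier[OF mat_diag_dim y] v(1), of d]
      by (simp add: y_def[symmetric])
    also have "mat_diag n d *\<^sub>v y = vec n (\<lambda>i. d i * y $ i)"
      using y by (intro eq_vecI) (auto simp: mat_diag_def scalar_prod_def if_distrib[where f = "\<lambda>x. x * _"] cong: if_cong)
    also have "y \<bullet> \<dots> = (\<Sum>i\<in>{0..<n}. d i * (y $ i)\<^sup>2)"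
      by (simp add: scalar_prod_def power2_eq_square mult_ac)
    also have "\<dots> > 0"
      using k d by (intro sum_pos2[of _ k]) (auto simp: less_imp_le)
    finally show ?thesis .
  qed
  moreover have "dim_row U = n" using U(1) by simp
  ultimately show ?thesis using A sym by (simp add: sym_pos_def_def)
qed

lemma diagonalization_eigenvector:
  fixes U :: "real mat"
  assumes U: "U \<in> carrier_mat n n" "U\<^sup>T * U = 1\<^sub>m n" and i: "i < n"
  shows "(U * mat_diag n d * U\<^sup>T) *\<^sub>v col U i = d i \<cdot>\<^sub>v col U i" "col U i \<bullet> col U i = 1"
proof -
  have u: "col U i \<in> carrier_vec n" using U(1) by auto
  have "U\<^sup>T *\<^sub>v col U i = (U\<^sup>T * U) *\<^sub>v unit_vec n i"
    using U(1) i by (simp add: mult_unit_vec_eq_col)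
  then have Uu: "U\<^sup>T *\<^sub>v col U i = unit_vec n i" using U by simp
  have "mat_diag n d *\<^sub>v unit_vec n i = d i \<cdot>\<^sub>v unit_vec n i"
    using i by (intro eq_vecI) (auto simp: mat_diag_def)
  moreover have "(U * mat_diag n d * U\<^sup>T) *\<^sub>v col U i = U *\<^sub>v (mat_diag n d *\<^sub>v unit_vec n i)"
    using U(1) u mat_diag_dim[of n d] by (simp add: assoc_mult_mat_vec[of _ n n _ n] Uu
        mult_carrier_mat[of _ n n] del: assoc_mult_mat)
  ultimately show "(U * mat_diag n d * U\<^sup>T) *\<^sub>v col U i = d i \<cdot>\<^sub>v col U i"
    using i by (simp add: mult_mat_vec[OF U(1)] mult_unit_vec_eq_col[OF U(1)])
  show "col U i \<bullet> col U i = 1"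
    using arg_cong[OF U(2), of "\<lambda>M. M $$ (i, i)"] U(1) i by simp
qed

lemma sym_pos_defD:
  assumes "sym_pos_def A" "A \<in> carrier_mat n n"
  shows "A\<^sup>T = A" "\<And>v. v \<in> carrier_vec n \<Longrightarrow> v \<noteq> 0\<^sub>v n \<Longrightarrow> v \<bullet> (A *\<^sub>v v) > 0"
  using assms by (auto simp: sym_pos_def_def)

text \<open>The eigenvalues in a diagonalization of \<open>A\<close> are positive, as testing the
  quadratic form on the columns of \<open>U\<close> shows. Replacing them by their square roots
  gives the root.\<close>

lemma sym_pos_def_sqrt_exists:
  assumes A: "A \<in> carrier_mat n n" "sym_pos_def A"
  shows "\<exists>S \<in> carrier_mat n n. sym_pos_def S \<and> S * S = A"
proof -
  note spd = sym_pos_defD[OF A(2,1)]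
  obtain U d where U: "U \<in> carrier_mat n n" "U\<^sup>T * U = 1\<^sub>m n" and AU: "A = U * mat_diag n d * U\<^sup>T"
    using real_symmetric_diagonalization[OF A(1) spd(1)] by blast
  have d: "d i > 0" if i: "i < n" for i
  proof -
    have u: "col U i \<in> carrier_vec n" using U by auto
    note ev = diagonalization_eigenvector(1)[OF U i, of d] diagonalization_eigenvector(2)[OF U i]
    have "col U i \<noteq> 0\<^sub>v n" using ev(2) by auto
    from spd(2)[OF u this] show ?thesis
      using ev u by (simp add: AU)
  qed
  let ?D = "mat_diag n (\<lambda>i. sqrt (d i))"
  have DD: "?D * ?D = mat_diag n d"
    unfolding mat_diag_diag using d by (intro eq_matI) (auto simp: mat_diag_def abs_of_pos)
  let ?S = "U * ?D * U\<^sup>T"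
  have "?S * ?S = U * (?D * ((U\<^sup>T * U) * (?D * U\<^sup>T)))"
    using U(1) mat_diag_dim[of n "\<lambda>i. sqrt (d i)"] by (simp add: mult_carrier_mat[of _ n n]
      assoc_mult_mat[of _ n n _ n _ n] del: mat_diag_diag assoc_mult_mat)
  also have "\<dots> = U * ((?D * ?D) * U\<^sup>T)"
    using U mat_diag_dim[of n "\<lambda>i. sqrt (d i)"] by (simp add: mult_carrier_mat[of _ n n]
      left_mult_one_mat[of _ n n]
      assoc_mult_mat[of _ n n _ n _ n] del: mat_diag_diag assoc_mult_mat)
  also have "\<dots> = A"
    unfolding DD AU using U(1) mat_diag_dim[of n d] by (simp add: mult_carrier_mat[of _ n n]
      assoc_mult_mat[of _ n n _ n _ n] del: assoc_mult_mat)
  finally have "?S * ?S = A" .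
  moreover have "sym_pos_def ?S"
    using d by (intro sym_pos_def_if_eigenvalues_pos[OF U]) simp
  moreover have "?S \<in> carrier_mat n n"
    using U by (simp add: mult_carrier_mat[of _ n n])
  ultimately show ?thesis by blast
qed

text \<open>An eigenvector \<open>u\<close> of \<open>S - R\<close> with eigenvalue \<open>d\<close> satisfies
  \<open>d (u \<bullet> S u + u \<bullet> R u) = u \<bullet> (S S - R R) u\<close>, so all eigenvalues of \<open>S - R\<close> vanish.\<close>
lemma sym_pos_def_sqrt_unique:
  assumes S: "S \<in> carrier_mat n n" "sym_pos_def S" and R: "R \<in> carrier_mat n n" "sym_pos_def R"
    and eq: "S * S = R * R"
  shows "S = R"
proof -
  note s = sym_pos_defD[OF S(2,1)] and r = sym_pos_defD[OF R(2,1)]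
  let ?D = "S - R"
  have D: "?D \<in> carrier_mat n n" using R by auto
  have sym: "?D\<^sup>T = ?D"
    using S(1) R(1) by (simp add: transpose_minus[of _ n n] s r)
  obtain U d where U: "U \<in> carrier_mat n n" "U\<^sup>T * U = 1\<^sub>m n" and DU: "?D = U * mat_diag n d * U\<^sup>T"
    using real_symmetric_diagonalization[OF D sym] by blast
  have "d i = 0" if i: "i < n" for i
  proof -
    define u where "u = col U i"
    have u: "u \<in> carrier_vec n" using U by (auto simp: u_def)
    have Du: "S *\<^sub>v u - R *\<^sub>v u = d i \<cdot>\<^sub>v u" and uu: "u \<bullet> u = 1"
      using diagonalization_eigenvector(1)[OF U i, of d] diagonalization_eigenvector(2)[OF U i] S R u
      by (simp_all add: u_def DU[symmetric] minus_mult_distrib_mat_vec[of _ n n])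
    then have "u \<noteq> 0\<^sub>v n" by auto
    then have pos: "u \<bullet> (S *\<^sub>v u) > 0" "u \<bullet> (R *\<^sub>v u) > 0"
      using s(2)[OF u] r(2)[OF u] by auto
    have "d i * (u \<bullet> (S *\<^sub>v u)) + d i * (u \<bullet> (R *\<^sub>v u))
        = (S *\<^sub>v u) \<bullet> (d i \<cdot>\<^sub>v u) + (d i \<cdot>\<^sub>v u) \<bullet> (R *\<^sub>v u)"
      using u S R by (simp add: comm_scalar_prod[of u n "S *\<^sub>v u"])
    \<comment> \<open>Substituting \<open>S *\<^sub>v u - R *\<^sub>v u\<close> for
      \<open>d i \<cdot>\<^sub>v u\<close> makes the mixed products of \<open>S *\<^sub>v u\<close>
      and \<open>R *\<^sub>v u\<close> cancel.\<close>
    also have "\<dots> = (S *\<^sub>v u) \<bullet> (S *\<^sub>v u) - (R *\<^sub>v u) \<bullet> (R *\<^sub>v u)"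
      using u S R by (simp add: Du[symmetric] scalar_prod_minus_distrib[of _ n] minus_scalar_prod_distrib[of _ n])
    also have "\<dots> = u \<bullet> ((S * S) *\<^sub>v u) - u \<bullet> ((R * R) *\<^sub>v u)"
      using u S R by (simp add: symmetric_mat_scalar_prod[of _ n] s r)
    also have "\<dots> = 0" by (simp add: eq)
    finally have "d i * (u \<bullet> (S *\<^sub>v u) + u \<bullet> (R *\<^sub>v u)) = 0" by (simp add: distrib_left)
    then show ?thesis using pos by simp
  qed
  then have "mat_diag n d = 0\<^sub>m n n" by (intro eq_matI) (auto simp: mat_diag_def)
  then have "?D = 0\<^sub>m n n" using DU U by (simp add: left_mult_zero_mat[of _ n n])
  then show ?thesis by (rule mat_eq_if_minus_eq_0[OF _ S(1) R(1)])
qed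

text \<open>\<open>spd_sqrt\<close> is a definite description, so its properties rest on existence
  and uniqueness together.\<close>

lemma spd_sqrt:
  assumes "A \<in> carrier_mat n n" "sym_pos_def A"
  shows "spd_sqrt A \<in> carrier_mat n n" "sym_pos_def (spd_sqrt A)" "spd_sqrt A * spd_sqrt A = A"
proof -
  have "\<exists>!S. S \<in> carrier_mat (dim_row A) (dim_row A) \<and> sym_pos_def S \<and> S * S = A"
    using sym_pos_def_sqrt_exists[OF assms] sym_pos_def_sqrt_unique[of _ n] assms(1) by auto
  from theI'[OF this] show "spd_sqrt A \<in> carrier_mat n n" "sym_pos_def (spd_sqrt A)"
    "spd_sqrt A * spd_sqrt A = A"
    using assms(1) by (auto simp: spd_sqrt_def)
qed

section \<open>Full column rank and Gram matrices\<close>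

lemma (in vec_space) rank_less_if_not_distinct_cols:
  assumes A: "A \<in> carrier_mat n nc" and "\<not> distinct (cols A)"
  shows "rank A < nc"
proof -
  obtain S where S: "maximal S (\<lambda>T. T \<subseteq> set (cols A) \<and> lin_indpt T)"
    using maximal_exists[of "(\<lambda>T. T \<subseteq> set (cols A) \<and> lin_indpt T)" "card (set (cols A))" "{}"]
    by (meson List.finite_set card_mono empty_iff empty_subsetI finite_lin_indpt2 rev_finite_subset)
  \<comment> \<open>The rank counts a maximal independent subset of the set of columns, and a set
    does not record repetitions.\<close>
  have "rank A = card S" by (rule rank_card_indpt[OF A S])
  also have "\<dots> \<le> card (set (cols A))" using S by (simp add: card_mono maximal_def)
  also have "\<dots> < length (cols A)"
    using assms(2) by (meson card_distinct card_length le_neq_implies_less)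
  finally show ?thesis using A by simp
qed

text \<open>Independence is stated for the set of columns, so a nonzero kernel vector contradicts it
  only once the columns are known to be distinct; full rank gives both facts.\<close>

lemma full_column_rank_mult_vec_eq_0D:
  assumes "full_column_rank A" "A \<in> carrier_mat n nc" "v \<in> carrier_vec nc" "A *\<^sub>v v = 0\<^sub>v n"
  shows "v = 0\<^sub>v nc"
proof -
  interpret vec_space "TYPE(real)" n .
  have r: "rank A = nc" using assms by (auto simp: full_column_rank_def)
  then have "distinct (cols A)" using rank_less_if_not_distinct_cols[OF assms(2)] by auto
  then show ?thesis
    using lin_depI[OF assms(2,3) _ assms(4)] full_rank_lin_indpt[OF assms(2) r] by blast
qed

text \<open>The quadratic form at \<open>v\<close> is the squared length of
  \<open>X *\<^sub>v v\<close>, and full column rank leaves no nonzero kernel vector.\<close>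

lemma sym_pos_def_gram:
  assumes X: "X \<in> carrier_mat I J" and "full_column_rank X"
  shows "sym_pos_def (X\<^sup>T * X)"
proof -
  have "v \<bullet> ((X\<^sup>T * X) *\<^sub>v v) > 0" if v: "v \<in> carrier_vec J" "v \<noteq> 0\<^sub>v J" for v
  proof -
    have "X *\<^sub>v v \<noteq> 0\<^sub>v I" using full_column_rank_mult_vec_eq_0D assms v by blast
    then have "(X *\<^sub>v v) \<bullet> (X *\<^sub>v v) > 0"
      using scalar_prod_self_pos[of "X *\<^sub>v v" I] X v by simp
    then show ?thesis
      using transpose_vec_mult_scalar[OF X v(1), of "X *\<^sub>v v"] X v
      by (simp add: assoc_mult_mat_vec[of _ J I _ J] comm_scalar_prod[of v J])
  qed
  then show ?thesis
    using X by (simp add: sym_pos_def_def transpose_mult[of _ J I _ J])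
qed

section \<open>Invertibility of the root and transfer of Z-eigenvalues\<close>

lemma sym_pos_def_surj:
  assumes S: "S \<in> carrier_mat n n" "sym_pos_def S" and y: "y \<in> carrier_vec n"
  obtains f where "f \<in> carrier_vec n" "S *\<^sub>v f = y"
proof -
  have "det S \<noteq> 0"
  proof
    assume "det S = 0"
    then obtain v where "v \<in> carrier_vec n" "v \<noteq> 0\<^sub>v n" "S *\<^sub>v v = 0\<^sub>v n"
      using det_0_iff_vec_prod_zero_field[OF S(1)] by blast
    then show False using sym_pos_defD(2)[OF S(2,1), of v] by simp
  qed
  then obtain B where B: "B \<in> carrier_mat n n" "S * B = 1\<^sub>m n"
    using det_non_zero_imp_unit[OF S(1)] S(1) by (auto simp: Units_def ring_mat_def)
  show thesis
    using that[of "B *\<^sub>v y"] assoc_mult_mat_vec[OF S(1) B(1) y] B y by simp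
qed

lemma sym_pos_def_inj:
  assumes S: "S \<in> carrier_mat n n" "sym_pos_def S"
    and xy: "x \<in> carrier_vec n" "y \<in> carrier_vec n" and eq: "S *\<^sub>v x = S *\<^sub>v y"
  shows "x = y"
proof -
  have "S *\<^sub>v (x - y) = 0\<^sub>v n"
    using S xy by (simp add: mult_minus_distrib_mat_vec[OF S(1)] eq)
  moreover have d: "x - y \<in> carrier_vec n" using xy by auto
  ultimately have "x - y = 0\<^sub>v n"
    using sym_pos_defD(2)[OF S(2,1) d] d by fastforce
  then show ?thesis by (rule vec_eq_if_minus_eq_0[OF _ xy])
qed

text \<open>Both squared lengths are the quadratic form of the common Gram matrix at
  \<open>f\<close>. Passing between \<open>X *\<^sub>v f\<close> and \<open>S *\<^sub>v f\<close>
  thus preserves the normalization as well as the argument at which \<open>G\<close> is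
  applied.\<close>

lemma gram_eq_imp_isometry:
  fixes X S :: "real mat"
  assumes X: "X \<in> carrier_mat I J" and S: "S \<in> carrier_mat J J" "S\<^sup>T = S"
    and eq: "S * S = X\<^sup>T * X" and f: "f \<in> carrier_vec J"
  shows "(X *\<^sub>v f) \<bullet> (X *\<^sub>v f) = (S *\<^sub>v f) \<bullet> (S *\<^sub>v f)"
    and "X\<^sup>T *\<^sub>v (X *\<^sub>v f) = S *\<^sub>v (S *\<^sub>v f)"
proof -
  have X': "X\<^sup>T \<in> carrier_mat J I" using X by simp
  show *: "X\<^sup>T *\<^sub>v (X *\<^sub>v f) = S *\<^sub>v (S *\<^sub>v f)"
    using assoc_mult_mat_vec[OF X' X f] assoc_mult_mat_vec[OF S(1) S(1) f] by (simp add: eq)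
  show "(X *\<^sub>v f) \<bullet> (X *\<^sub>v f) = (S *\<^sub>v f) \<bullet> (S *\<^sub>v f)"
    using transpose_vec_mult_scalar[OF X f mult_mat_vec_carrier[OF X f]]
      transpose_vec_mult_scalar[OF S(1) f mult_mat_vec_carrier[OF S(1) f]] by (simp add: * S(2))
qed

lemma dim_tensor_apply [simp]: "dim_vec (tensor_apply T x) = last (dims T)"
  by (simp add: tensor_apply_def)

theorem theorem12:
  fixes N I J :: nat and T G Ghat :: tensor and X :: "real mat"
  assumes "N \<ge> 2"
    and "dims T = replicate N I" and "symmetric_tensor T"
    and "dims G = replicate N J" and "X \<in> carrier_mat I J"
    and "T = tucker G (replicate N X)" and "full_column_rank X"
    and "Ghat = tucker G (replicate N (spd_sqrt (X\<^sup>T * X)))"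
  shows "(\<forall>\<mu>. Z_eigenvalue Ghat \<mu> \<longrightarrow> Z_eigenvalue T \<mu>) \<and>
         (\<forall>\<mu>. \<mu> \<noteq> 0 \<and> Z_eigenvalue T \<mu> \<longrightarrow> Z_eigenvalue Ghat \<mu>)"
proof -
  have N: "N \<ge> 1" using assms(1) by simp
  note X = assms(5)
  define S where "S = spd_sqrt (X\<^sup>T * X)"
  have "X\<^sup>T * X \<in> carrier_mat J J" using X by simp
  from spd_sqrt[OF this sym_pos_def_gram[OF X assms(7)]]
  have S: "S \<in> carrier_mat J J" and spd: "sym_pos_def S" and SS: "S * S = X\<^sup>T * X"
    by (simp_all add: S_def)
  have St: "S\<^sup>T = S" by (rule sym_pos_defD(1)[OF spd S])
  note isom = gram_eq_imp_isometry[OF X S St SS]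
  define F where "F = tensor_apply G"
  have F: "F y \<in> carrier_vec J" for y
    using N assms(4) by (intro carrier_vecI) (simp add: F_def)
  have applyT: "tensor_apply T x = X *\<^sub>v F (X\<^sup>T *\<^sub>v x)" if "x \<in> carrier_vec I" for x
    unfolding assms(6) F_def by (rule tensor_apply_tucker[OF N assms(4) X that])
  have applyG: "tensor_apply Ghat y = S *\<^sub>v F (S *\<^sub>v y)" if "y \<in> carrier_vec J" for y
    using tensor_apply_tucker[OF N assms(4) S that] by (simp add: assms(8) F_def S_def[symmetric] St)
  have "dims Ghat = replicate N J"
    unfolding assms(8) S_def[symmetric] using dims_tucker[of G "replicate N S"] assms(4) S by simp
  then have last: "last (dims T) = I" "last (dims Ghat) = J"
    using N assms(2) by simp_all
  show ?thesis
  proof (intro conjI allI impI)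
    fix \<mu> assume "Z_eigenvalue Ghat \<mu>"
    then obtain y where y: "y \<in> carrier_vec J" "S *\<^sub>v F (S *\<^sub>v y) = \<mu> \<cdot>\<^sub>v y" "y \<bullet> y = 1"
      by (auto simp: Z_eigenvalue_def last applyG)
    obtain f where f: "f \<in> carrier_vec J" "S *\<^sub>v f = y"
      using sym_pos_def_surj[OF S spd y(1)] .
    define x where "x = X *\<^sub>v f"
    have x: "x \<in> carrier_vec I" using X f by (simp add: x_def)
    have e: "S *\<^sub>v F (S *\<^sub>v y) = S *\<^sub>v (\<mu> \<cdot>\<^sub>v f)"
      using y f by (simp add: mult_mat_vec[OF S])
    \<comment> \<open>\<open>S\<close> is cancelled by injectivity; there is no division by \<mu>,
      so the eigenvalue 0 is covered.\<close>
    have "F (S *\<^sub>v y) = \<mu> \<cdot>\<^sub>v f"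
      by (rule sym_pos_def_inj[OF S spd _ _ e]) (use F f in auto)
    then have "tensor_apply T x = \<mu> \<cdot>\<^sub>v x"
      using isom(2)[OF f(1)] f x by (simp add: applyT x_def mult_mat_vec[OF X])
    moreover have "x \<bullet> x = 1" using isom(1)[OF f(1)] y f by (simp add: x_def)
    ultimately show "Z_eigenvalue T \<mu>" using x by (auto simp: Z_eigenvalue_def last)
  next
    fix \<mu> assume \<mu>: "\<mu> \<noteq> 0 \<and> Z_eigenvalue T \<mu>"
    then obtain x where x: "x \<in> carrier_vec I" "X *\<^sub>v F (X\<^sup>T *\<^sub>v x) = \<mu> \<cdot>\<^sub>v x" "x \<bullet> x = 1"
      by (auto simp: Z_eigenvalue_def last applyT)
    \<comment> \<open>Dividing the eigenvalue equation by \<mu> exhibits a preimage of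
      \<open>x\<close> under \<open>X\<close>; this is where \<mu> must be nonzero.\<close>
    define f where "f = (1 / \<mu>) \<cdot>\<^sub>v F (X\<^sup>T *\<^sub>v x)"
    have f: "f \<in> carrier_vec J" using F by (simp add: f_def)
    have xf: "X *\<^sub>v f = x"
      using \<mu> x F by (simp add: f_def mult_mat_vec[OF X] smult_smult_assoc)
    define y where "y = S *\<^sub>v f"
    have y: "y \<in> carrier_vec J" using S f by (simp add: y_def)
    \<comment> \<open>\<open>S *\<^sub>v y\<close> is \<open>S *\<^sub>v (S *\<^sub>v f)\<close>,
      hence \<open>X\<^sup>T *\<^sub>v (X *\<^sub>v f)\<close>, and \<open>X *\<^sub>v f\<close> is
      \<open>x\<close>.\<close>
    have "F (S *\<^sub>v y) = F (X\<^sup>T *\<^sub>v x)" using isom(2)[OF f] by (simp add: y_def xf)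
    also have "\<dots> = \<mu> \<cdot>\<^sub>v f" using \<mu> by (simp add: f_def smult_smult_assoc)
    finally have "tensor_apply Ghat y = \<mu> \<cdot>\<^sub>v y"
      using y f by (simp add: applyG mult_mat_vec[OF S]) (simp add: y_def)
    moreover have "y \<bullet> y = 1" using isom(1)[OF f] x by (simp add: y_def xf)
    ultimately show "Z_eigenvalue Ghat \<mu>" using y by (auto simp: Z_eigenvalue_def last)
  qed
qed

end
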